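(* For every integer $n\geqslant 0$, $$p(n) = \sum_{k=3}^{n+3} P_{\phi}(k)\, S^{(3)}_{n+3,k},$$ where $P_\phi(k)=\phi(k)/2$.
   Context: $p(n)$ is the number of partitions of $n$, with $p(0)=1$. A partition of a positive integer $m$ is a nonincreasing sequence of positive integers (its parts) summing to $m$. For integers $r\ge 1$, $k\ge 1$, $m\ge 1$, $S^{(r)}_{m,k}$ denotes the number of parts equal to $k$ (counted with multiplicity) summed over all partitions of $m$ whose smallest part is at least $r$. $\phi$ is Euler's totient function, and $P_\phi(k)=\phi(k)/2$ (for $k>2$ this equals the number of partitions of $k$ into two relatively prime parts). *)

theory Defs
  imports Complex_Main "HOL-Number_Theory.Totient"
begin

definition partitions :: "nat \<Rightarrow> nat list set" where
  "partitions m = {xs. sorted_wrt (\<ge>) xs \<and> (\<forall>x\<in>set xs. 0 < x) \<and> sum_list xs = m}"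

(* The empty list is the only partition of 0, so num_partitions 0 = 1. *)
definition num_partitions :: "nat \<Rightarrow> nat" where
  "num_partitions n = card (partitions n)"

definition parts_count :: "nat \<Rightarrow> nat \<Rightarrow> nat \<Rightarrow> nat" where
  "parts_count r m k =
     (\<Sum>xs \<in> {xs \<in> partitions m. \<forall>x\<in>set xs. r \<le> x}. count_list xs k)"

definition P_phi :: "nat \<Rightarrow> real" where
  "P_phi k = real (totient k) / 2"

(* Finiteness matters: card and sum would silently be 0 on infinite sets. *)
lemma finite_partitions: "finite (partitions m)"
proof (rule finite_subset)
  have "length xs \<le> sum_list xs" if "\<forall>x\<in>set xs. 0 < x" for xs :: "nat list"
    using that by (induction xs) auto
  then show "partitions m \<subseteq> {xs. set xs \<subseteq> {..m} \<and> length xs \<le> m}"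
    by (auto simp: partitions_def member_le_sum_list)
  show "finite {xs. set xs \<subseteq> {..m} \<and> length xs \<le> m}"
    by (rule finite_lists_length_le) simp
qed

lemma num_partitions_0: "num_partitions 0 = 1"
proof -
  have "partitions 0 = {[]}"
    by (auto simp: partitions_def) (metis list.set_intros(1) neq_Nil_conv less_irrefl)
  then show ?thesis by (simp add: num_partitions_def)
qed

end

theory Submission imports Defs "HOL-Library.Multiset" begin

text \<open>
  Let q(m) be the number of partitions of m with all parts at least 3. Removing copies of k shows
  that the number of parts k in such partitions is the sum of q(m - N) over the positive multiples
  N of k. Summing over k against the totient and using that the totients of all divisors of N add
  up to N, the coefficient of q(m - N) becomes N - 1 - [2 dvd N] = 2 ((N - 1) div 2), the
  divisors 1 and 2 being absent. For m = n + 3 and N = M + 3 half of this is M div 2 + 1, the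
  number of partitions of M into parts 1 and 2, so the sum counts all partitions of n by the
  total size M of their parts below 3.
\<close>

text \<open>With multisets, adding or removing one copy of a part needs no re-sorting. For
  \<open>r = 0\<close> these sets are infinite, as zeros may be added freely; hence the assumptions
  \<open>0 < r\<close> below.\<close>

definition mpartitions :: "nat \<Rightarrow> nat \<Rightarrow> nat multiset set" where
  "mpartitions r m = {M. (\<forall>x\<in>#M. r \<le> x) \<and> sum_mset M = m}"

definition num_mpartitions :: "nat \<Rightarrow> nat \<Rightarrow> nat" where
  "num_mpartitions r m = card (mpartitions r m)"

lemma bij_betw_mset_partitions:
  assumes "0 < r"
  shows "bij_betw mset {xs \<in> partitions m. \<forall>x\<in>set xs. r \<le> x} (mpartitions r m)"
proof (rule bij_betw_byWitness[where f' = "\<lambda>M. rev (sorted_list_of_multiset M)"])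
  have *: "sorted_list_of_multiset (mset xs) = rev xs" if "sorted_wrt (\<ge>) xs" for xs :: "nat list"
  proof -
    have "sorted (rev xs)" using that by (simp add: sorted_wrt_rev)
    then show ?thesis by (metis mset_rev sorted_list_of_multiset_mset sorted_sort_id)
  qed
  then show "\<forall>xs\<in>{xs \<in> partitions m. \<forall>x\<in>set xs. r \<le> x}.
      rev (sorted_list_of_multiset (mset xs)) = xs"
    by (simp add: partitions_def)
  show "\<forall>M\<in>mpartitions r m. mset (rev (sorted_list_of_multiset M)) = M" by simp
  show "mset ` {xs \<in> partitions m. \<forall>x\<in>set xs. r \<le> x} \<subseteq> mpartitions r m"
    by (auto simp: mpartitions_def partitions_def sum_mset_sum_list)
  show "(\<lambda>M. rev (sorted_list_of_multiset M)) ` mpartitions r m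
      \<subseteq> {xs \<in> partitions m. \<forall>x\<in>set xs. r \<le> x}"
  proof safe
    fix M assume M: "M \<in> mpartitions r m"
    have "sum_list (rev (sorted_list_of_multiset M)) = sum_mset M"
      by (metis mset_rev mset_sorted_list_of_multiset sum_mset_sum_list)
    then show "rev (sorted_list_of_multiset M) \<in> partitions m"
      using M assms by (auto simp: mpartitions_def partitions_def sorted_wrt_rev)
  qed (auto simp: mpartitions_def)
qed

lemma finite_mpartitions: "0 < r \<Longrightarrow> finite (mpartitions r m)"
  using bij_betw_finite[OF bij_betw_mset_partitions] finite_partitions by auto

lemma num_partitions_eq_mpartitions: "num_partitions m = num_mpartitions 1 m"
proof -
  have "{xs \<in> partitions m. \<forall>x\<in>set xs. 1 \<le> x} = partitions m"
    by (auto simp: partitions_def Suc_le_eq)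
  then show ?thesis
    using bij_betw_same_card[OF bij_betw_mset_partitions[of 1 m]]
    by (simp add: num_partitions_def num_mpartitions_def)
qed

lemma parts_count_eq_mpartitions:
  assumes "0 < r"
  shows "parts_count r m k = (\<Sum>M\<in>mpartitions r m. count M k)"
  unfolding parts_count_def
  by (rule sum.reindex_bij_betw[OF bij_betw_mset_partitions[OF assms], of "\<lambda>M. count M k",
        simplified count_mset])

text \<open>The inverse map removes one copy of \<open>k\<close>. The bound \<open>r \<le> k\<close>
  keeps the enlarged multiset admissible, and \<open>k \<le> m\<close> keeps \<open>m - k\<close>
  from being truncated.\<close>

lemma mpartitions_containing:
  assumes "r \<le> k" "k \<le> m"
  shows "{M \<in> mpartitions r m. k \<in># M} = add_mset k ` mpartitions r (m - k)"
proof safe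
  fix M assume "M \<in> mpartitions r m" "k \<in># M"
  moreover from \<open>k \<in># M\<close> obtain N where "M = add_mset k N" by (metis mset_add)
  ultimately show "M \<in> add_mset k ` mpartitions r (m - k)"
    by (auto simp: mpartitions_def)
qed (use assms in \<open>auto simp: mpartitions_def\<close>)

lemma mpartitions_containing_empty:
  assumes "m < k" shows "{M \<in> mpartitions r m. k \<in># M} = {}"
proof -
  have "k \<le> sum_mset M" if "k \<in># M" for M
    using that by (metis le_add1 mset_add sum_mset.add_mset)
  then show ?thesis using assms by (fastforce simp: mpartitions_def)
qed

text \<open>Either no part equals \<open>r\<close>, so all parts are at least \<open>Suc r\<close>,
  or one copy of \<open>r\<close> can be removed.\<close>

lemma num_mpartitions_rec:
  assumes "0 < r"
  shows "num_mpartitions r m =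
    num_mpartitions (Suc r) m + (if r \<le> m then num_mpartitions r (m - r) else 0)"
proof -
  let ?C = "{M \<in> mpartitions r m. r \<in># M}"
  have split: "mpartitions r m = mpartitions (Suc r) m \<union> ?C"
    by (auto simp: mpartitions_def Suc_le_eq le_less dest: le_neq_trans)
  have "num_mpartitions r m = num_mpartitions (Suc r) m + card ?C"
    unfolding num_mpartitions_def
  proof (subst split, rule card_Un_disjoint)
    show "mpartitions (Suc r) m \<inter> ?C = {}" by (auto simp: mpartitions_def)
  qed (use assms in \<open>simp_all add: finite_mpartitions\<close>)
  moreover have "card ?C = (if r \<le> m then num_mpartitions r (m - r) else 0)"
    by (auto simp: mpartitions_containing mpartitions_containing_empty num_mpartitions_def
        card_image inj_on_def)
  ultimately show ?thesis by simp
qed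

text \<open>Only partitions containing \<open>k\<close> contribute. Taking one copy of
  \<open>k\<close> out of each lowers its count by one, and these ones add up to the number of
  partitions of \<open>m - k\<close>.\<close>

lemma parts_count_rec:
  assumes "0 < r" "r \<le> k" "k \<le> m"
  shows "parts_count r m k = num_mpartitions r (m - k) + parts_count r (m - k) k"
proof -
  have "parts_count r m k = (\<Sum>M\<in>{M \<in> mpartitions r m. k \<in># M}. count M k)"
    unfolding parts_count_eq_mpartitions[OF assms(1)]
    by (rule sum.mono_neutral_right)
      (use assms in \<open>auto simp: finite_mpartitions not_in_iff\<close>)
  also have "\<dots> = (\<Sum>M\<in>mpartitions r (m - k). Suc (count M k))"
    by (simp add: mpartitions_containing[OF assms(2,3)] sum.reindex inj_on_def)
  also have "\<dots> = num_mpartitions r (m - k) + parts_count r (m - k) k"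
    using assms by (simp add: parts_count_eq_mpartitions num_mpartitions_def sum_Suc)
  finally show ?thesis .
qed

lemma parts_count_eq_sum_multiples:
  assumes "0 < r" "r \<le> k"
  shows "parts_count r m k = (\<Sum>N | N \<in> {1..m} \<and> k dvd N. num_mpartitions r (m - N))"
proof (induction m rule: less_induct)
  case (less m)
  show ?case
  proof (cases "k \<le> m")
    case False
    then have "{N. N \<in> {1..m} \<and> k dvd N} = {}" by (auto dest: dvd_imp_le)
    moreover have "parts_count r m k = 0"
      using mpartitions_containing_empty[of m k r] False assms
      by (auto simp: parts_count_eq_mpartitions not_in_iff)
    ultimately show ?thesis by (simp only: sum.empty)
  next
    case True
    \<comment> \<open>The multiples of \<open>k\<close> up to \<open>m\<close> are \<open>k\<close>
      itself and the multiples up to \<open>m - k\<close> shifted by \<open>k\<close>, which matches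
      one step of \<open>parts_count_rec\<close>.\<close>
    let ?A = "{N. N \<in> {1..m - k} \<and> k dvd N}"
    have "N \<in> insert k ((+) k ` ?A)" if N: "N \<in> {1..m}" "k dvd N" for N
    proof (cases "N = k")
      case False
      have "k \<le> N" using N by (auto dest: dvd_imp_le)
      then have "N = k + (N - k)" "N - k \<in> ?A" using N False by auto
      then show ?thesis by blast
    qed simp
    then have eq: "{N. N \<in> {1..m} \<and> k dvd N} = insert k ((+) k ` ?A)"
      using True assms by auto
    have "(\<Sum>N | N \<in> {1..m} \<and> k dvd N. num_mpartitions r (m - N))
        = num_mpartitions r (m - k) + (\<Sum>N\<in>?A. num_mpartitions r (m - k - N))"
      unfolding eq by (subst sum.insert) (auto simp: sum.reindex)
    also have "\<dots> = num_mpartitions r (m - k) + parts_count r (m - k) k"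
      using less[of "m - k"] True assms by simp
    finally show ?thesis using parts_count_rec[OF assms True] by simp
  qed
qed

lemma sum_totient_divisors_ge_3:
  assumes "0 < N" "N \<le> m"
  shows "(\<Sum>k | k \<in> {3..m} \<and> k dvd N. totient k) = 2 * ((N - 1) div 2)"
proof -
  \<comment> \<open>\<open>?D\<close> holds the divisors below 3, each of totient 1. As
    \<open>N \<le> m\<close>, all other divisors lie in \<open>?B\<close>.\<close>
  let ?B = "{k. k \<in> {3..m} \<and> k dvd N}" and ?D = "{k. k \<in> {1, 2} \<and> k dvd N}"
  have divisors: "{d. d dvd N} = ?D \<union> ?B"
  proof (intro equalityI subsetI)
    fix d assume "d \<in> {d. d dvd N}"
    then have "d dvd N" "0 < d" "d \<le> N" using assms by (auto dest: dvd_imp_le intro: Nat.gr0I)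
    then show "d \<in> ?D \<union> ?B" using assms by auto
  qed auto
  have "N = (\<Sum>d | d dvd N. totient d)"
    by (rule totient_divisor_sum[symmetric])
  also have "\<dots> = (\<Sum>d\<in>?D \<union> ?B. totient d)"
    by (simp only: divisors)
  also have "\<dots> = (\<Sum>d\<in>?D. totient d) + (\<Sum>d\<in>?B. totient d)"
    by (rule sum.union_disjoint) (simp_all, force)
  also have "(\<Sum>d\<in>?D. totient d) = (if even N then 2 else 1)"
  proof (cases "even N")
    case True
    then have "?D = {1, 2}" by auto
    then show ?thesis using True by simp
  next
    case False
    then have "?D = {1}" by auto
    then show ?thesis using False by simp
  qed
  finally have "N = (if even N then 2 else 1) + (\<Sum>d\<in>?B. totient d)" .
  moreover have "X = 2 * ((N - 1) div 2)" if "N = (if even N then 2 else 1) + X" for X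
    using that assms(1) by (cases "even N") (simp_all only: if_True if_False, presburger+)
  ultimately show ?thesis by blast
qed

text \<open>If the parts above 2 add up to \<open>j\<close>, the twos must fill
  \<open>n - j\<close>, which is possible in exactly one way when \<open>n - j\<close> is even and
  in none otherwise.\<close>

lemma num_mpartitions_2_eq_sum:
  "num_mpartitions 2 n = (\<Sum>j | j \<le> n \<and> even (n - j). num_mpartitions 3 j)"
proof (induction n rule: less_induct)
  case (less n)
  have rec: "num_mpartitions 2 n
      = num_mpartitions 3 n + (if 2 \<le> n then num_mpartitions 2 (n - 2) else 0)"
    using num_mpartitions_rec[of 2 n] by (simp add: numeral_3_eq_3)
  show ?case
  proof (cases "2 \<le> n")
    case True
    \<comment> \<open>Parity excludes \<open>j = n - 1\<close>, so every \<open>j\<close> other than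
      \<open>n\<close> is at most \<open>n - 2\<close>.\<close>
    have "{j. j \<le> n \<and> even (n - j)} = insert n {j. j \<le> n - 2 \<and> even (n - 2 - j)}"
    proof (intro equalityI subsetI)
      fix j assume "j \<in> {j. j \<le> n \<and> even (n - j)}"
      then show "j \<in> insert n {j. j \<le> n - 2 \<and> even (n - 2 - j)}"
        using True by simp presburger
    next
      fix j assume "j \<in> insert n {j. j \<le> n - 2 \<and> even (n - 2 - j)}"
      then show "j \<in> {j. j \<le> n \<and> even (n - j)}"
        using True by simp presburger
    qed
    then show ?thesis using rec True less[of "n - 2"] by simp
  next
    case False
    then have "{j. j \<le> n \<and> even (n - j)} = {n}" by (auto, presburger)
    then show ?thesis using rec False by simp
  qed
qed

text \<open>The weight counts the ways to fill \<open>n - j\<close> with ones and twos, the number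
  of twos ranging from 0 to \<open>(n - j) div 2\<close>.\<close>

lemma num_mpartitions_1_eq_sum:
  "num_mpartitions 1 n = (\<Sum>j\<le>n. ((n - j) div 2 + 1) * num_mpartitions 3 j)"
proof (induction n)
  case 0
  have "{j. j = (0::nat) \<and> even (0 - j)} = {0}" by auto
  then show ?case
    using num_mpartitions_rec[of 1 0] num_mpartitions_2_eq_sum[of 0]
    by (simp add: numeral_2_eq_2)
next
  case (Suc n)
  let ?q = "num_mpartitions 3"
  have "num_mpartitions 1 (Suc n) = num_mpartitions 2 (Suc n) + num_mpartitions 1 n"
    using num_mpartitions_rec[of 1 "Suc n"] by (simp add: numeral_2_eq_2)
  also have "num_mpartitions 2 (Suc n) = (\<Sum>j\<le>Suc n. if even (Suc n - j) then ?q j else 0)"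
    unfolding num_mpartitions_2_eq_sum
    by (subst sum.inter_filter[symmetric]) simp_all
  also have "\<dots> = (\<Sum>j\<le>n. if even (Suc n - j) then ?q j else 0) + ?q (Suc n)" by simp
  also have "\<dots> + num_mpartitions 1 n
      = (\<Sum>j\<le>n. (if even (Suc n - j) then ?q j else 0) + ((n - j) div 2 + 1) * ?q j) + ?q (Suc n)"
    unfolding Suc by (simp add: sum.distrib)
  \<comment> \<open>The weight grows by one from \<open>n - j\<close> to \<open>Suc n - j\<close>
    exactly when the latter is even.\<close>
  also have "(\<Sum>j\<le>n. (if even (Suc n - j) then ?q j else 0) + ((n - j) div 2 + 1) * ?q j)
      = (\<Sum>j\<le>n. ((Suc n - j) div 2 + 1) * ?q j)"
  proof (rule sum.cong)
    fix j assume "j \<in> {..n}"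
    then have "Suc n - j = Suc (n - j)" by auto
    then show "(if even (Suc n - j) then ?q j else 0) + ((n - j) div 2 + 1) * ?q j
        = ((Suc n - j) div 2 + 1) * ?q j"
      by (cases "even (n - j)") (auto elim!: evenE oddE)
  qed simp
  finally show ?case by simp
qed

text \<open>The factor 2 clears the halves in \<open>P_phi\<close>, so the whole count stays in the
  natural numbers.\<close>

lemma sum_totient_parts_count:
  "(\<Sum>k = 3..n + 3. totient k * parts_count 3 (n + 3) k) = 2 * num_partitions n"
proof -
  let ?q = "num_mpartitions 3" and ?m = "n + 3"
  have "(\<Sum>k = 3..?m. totient k * parts_count 3 ?m k)
      = (\<Sum>k = 3..?m. \<Sum>N | N \<in> {1..?m} \<and> k dvd N. totient k * ?q (?m - N))"
    by (intro sum.cong) (simp_all add: parts_count_eq_sum_multiples sum_distrib_left)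
  \<comment> \<open>Exchanging the sums collects, for each \<open>N\<close>, the totients of its
    divisors from 3 on.\<close>
  also have "\<dots> = (\<Sum>N = 1..?m. \<Sum>k | k \<in> {3..?m} \<and> k dvd N. totient k * ?q (?m - N))"
    by (rule sum.swap_restrict) simp_all
  also have "\<dots> = (\<Sum>N = 1..?m. 2 * ((N - 1) div 2) * ?q (?m - N))"
    by (intro sum.cong refl, subst sum_distrib_right[symmetric], subst sum_totient_divisors_ge_3)
      simp_all
  \<comment> \<open>The terms for \<open>N = 1\<close> and \<open>N = 2\<close> vanish because
    \<open>(N - 1) div 2 = 0\<close>.\<close>
  also have "\<dots> = (\<Sum>N = 3..?m. 2 * ((N - 1) div 2) * ?q (?m - N))"
    by (rule sum.mono_neutral_right) auto
  \<comment> \<open>With \<open>j = n + 3 - N\<close> one has \<open>n - j = N - 3\<close>, and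
    \<open>(N - 1) div 2 = (N - 3) div 2 + 1\<close>; this is where the shift by 3 yields the
    required weight.\<close>
  also have "\<dots> = (\<Sum>j\<le>n. 2 * ((n - j) div 2 + 1) * ?q j)"
  proof (rule sum.reindex_bij_witness[where i = "\<lambda>j. ?m - j" and j = "\<lambda>N. ?m - N"])
    fix N assume "N \<in> {3..?m}"
    then have "n - (?m - N) = N - 3" "N - 1 = (N - 3) + 2" by auto
    then show "2 * ((n - (?m - N)) div 2 + 1) * ?q (?m - N) = 2 * ((N - 1) div 2) * ?q (?m - N)"
      by simp
  qed auto
  also have "\<dots> = 2 * num_partitions n"
    unfolding num_partitions_eq_mpartitions num_mpartitions_1_eq_sum
    by (simp only: sum_distrib_left mult.assoc)
  finally show ?thesis .
qed

theorem theorem3: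
  fixes n :: nat
  shows "real (num_partitions n) = (\<Sum>k = 3..n + 3. P_phi k * real (parts_count 3 (n + 3) k))"
proof -
  have "(\<Sum>k = 3..n + 3. P_phi k * real (parts_count 3 (n + 3) k))
      = real (\<Sum>k = 3..n + 3. totient k * parts_count 3 (n + 3) k) / 2"
    by (simp add: P_phi_def sum_divide_distrib)
  then show ?thesis by (simp only: sum_totient_parts_count)
qed

end
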